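(* Let $T$ be a self-adjoint operator on a dense domain $\mathcal{D}(T)$ of a complex separable Hilbert space $\mathcal{H}$ and define the Hermitian quadratic form $Q(\Phi):=\langle\Phi,T\Phi\rangle$ for $\Phi\in\mathcal{D}:=\mathcal{D}(T)$. Then $Q$ is closable.
   Context: A Hermitian quadratic form $Q$ with dense domain $\mathcal{D}\subset\mathcal{H}$ is called closable if for every sequence $\{\Phi_n\}_{n\in\mathbb{N}}\subset\mathcal{D}$ such that $\lim_{n\to\infty}\Phi_n=0$ in $\mathcal{H}$ and $\lim_{n,m\to\infty}Q(\Phi_n-\Phi_m)=0$ one has $\lim_{n\to\infty}Q(\Phi_n)=0$. No semiboundedness is assumed. *)

theory Defs
  imports "HOL-Analysis.Analysis"
begin

section \<open>Complex Hilbert spaces\<close>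

class complex_vector = real_vector +
  fixes scaleC :: "complex \<Rightarrow> 'a \<Rightarrow> 'a"  (infixr \<open>*\<^sub>C\<close> 75)
  assumes scaleC_add_right: "a *\<^sub>C (x + y) = a *\<^sub>C x + a *\<^sub>C y"
    and scaleC_add_left: "(a + b) *\<^sub>C x = a *\<^sub>C x + b *\<^sub>C x"
    and scaleC_scaleC: "a *\<^sub>C b *\<^sub>C x = (a * b) *\<^sub>C x"
    and scaleR_scaleC: "r *\<^sub>R x = complex_of_real r *\<^sub>C x"

global_interpretation complex_vector: vector_space "scaleC :: complex \<Rightarrow> 'a \<Rightarrow> 'a::complex_vector"
  defines csubspace = complex_vector.subspace
proof
  fix x :: 'a
  have "1 *\<^sub>C x = 1 *\<^sub>R x"
    by (simp only: scaleR_scaleC of_real_1)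
  then show "1 *\<^sub>C x = x"
    by simp
qed (simp_all add: scaleC_add_right scaleC_add_left scaleC_scaleC)

text \<open>
  The inner product is antilinear in the first and linear in the second argument. The underlying
  real Hilbert space structure is the one given by its real part, so that norm and topology come
  from the class \<^class>\<open>real_inner\<close>, and positive definiteness is inherited from
  there: see \<open>cinner_self\<close>, \<open>cinner_self_eq_zero_iff\<close> and
  \<open>norm_eq_sqrt_cinner\<close>.
\<close>

class complex_inner = complex_vector + real_inner +
  fixes cinner :: "'a \<Rightarrow> 'a \<Rightarrow> complex"
  assumes cinner_commute: "cinner x y = cnj (cinner y x)"
    and cinner_add_right: "cinner x (y + z) = cinner x y + cinner x z"
    and cinner_scaleC_right: "cinner x (c *\<^sub>C y) = c * cinner x y"
    and inner_eq_Re_cinner: "inner x y = Re (cinner x y)"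

class chilbert_space = complex_inner + complete_space

lemma cinner_self: "cinner x x = complex_of_real (inner x x)"
proof -
  have "Im (cinner x x) = 0"
    using arg_cong[OF cinner_commute[of x x], of Im] by simp
  then show ?thesis
    by (simp add: complex_eq_iff inner_eq_Re_cinner)
qed

lemma cinner_self_eq_zero_iff: "cinner x x = 0 \<longleftrightarrow> x = 0"
  by (simp add: cinner_self)

lemma norm_eq_sqrt_cinner: "norm x = sqrt (Re (cinner x x))"
  using norm_eq_sqrt_inner[of x] by (simp add: cinner_self)


section \<open>Unbounded operators\<close>

text \<open>
  An operator is a domain \<open>D\<close> together with a function \<open>T\<close> of which only
  the values on \<open>D\<close> matter.
\<close>

definition densely_defined_operator :: "'a::complex_inner set \<Rightarrow> ('a \<Rightarrow> 'a) \<Rightarrow> bool" where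
  "densely_defined_operator D T \<longleftrightarrow>
     csubspace D \<and> closure D = UNIV \<and>
     (\<forall>x\<in>D. \<forall>y\<in>D. T (x + y) = T x + T y) \<and>
     (\<forall>c. \<forall>x\<in>D. T (c *\<^sub>C x) = c *\<^sub>C T x)"

definition adjoint_domain :: "'a::complex_inner set \<Rightarrow> ('a \<Rightarrow> 'a) \<Rightarrow> 'a set" where
  "adjoint_domain D T = {y. \<exists>z. \<forall>x\<in>D. cinner y (T x) = cinner z x}"

text \<open>Well-defined on the adjoint domain when \<open>D\<close> is dense: see \<open>adjoint_operator_eqI\<close>.\<close>

definition adjoint_operator :: "'a::complex_inner set \<Rightarrow> ('a \<Rightarrow> 'a) \<Rightarrow> 'a \<Rightarrow> 'a" where
  "adjoint_operator D T y = (THE z. \<forall>x\<in>D. cinner y (T x) = cinner z x)"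

definition self_adjoint :: "'a::complex_inner set \<Rightarrow> ('a \<Rightarrow> 'a) \<Rightarrow> bool" where
  "self_adjoint D T \<longleftrightarrow>
     densely_defined_operator D T \<and>
     adjoint_domain D T = D \<and> (\<forall>x\<in>D. adjoint_operator D T x = T x)"

lemma adjoint_operator_eqI:
  assumes "closure D = UNIV" and z: "\<And>x. x \<in> D \<Longrightarrow> cinner y (T x) = cinner z x"
  shows "adjoint_operator D T y = z"
  unfolding adjoint_operator_def
proof (rule the_equality)
  fix z' assume z': "\<forall>x\<in>D. cinner y (T x) = cinner z' x"
  have "D \<subseteq> {x. inner (z' - z) x = 0}"
    using z z' by (simp add: subset_iff inner_diff_left) (simp add: inner_eq_Re_cinner)
  then have "closure D \<subseteq> {x. inner (z' - z) x = 0}"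
    by (rule closure_minimal) (rule closed_hyperplane)
  then have "inner (z' - z) (z' - z) = 0"
    using assms(1) by blast
  then show "z' = z"
    by simp
qed (use z in blast)


section \<open>Hermitian quadratic forms\<close>

definition hermitian_sesquilinear_form ::
    "'a::complex_vector set \<Rightarrow> ('a \<Rightarrow> 'a \<Rightarrow> complex) \<Rightarrow> bool" where
  "hermitian_sesquilinear_form D S \<longleftrightarrow>
     (\<forall>x\<in>D. \<forall>y\<in>D. \<forall>z\<in>D. S x (y + z) = S x y + S x z) \<and>
     (\<forall>c. \<forall>x\<in>D. \<forall>y\<in>D. S x (c *\<^sub>C y) = c * S x y) \<and>
     (\<forall>x\<in>D. \<forall>y\<in>D. S x y = cnj (S y x))"

definition hermitian_quadratic_form ::
    "'a::complex_vector set \<Rightarrow> ('a \<Rightarrow> complex) \<Rightarrow> bool" where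
  "hermitian_quadratic_form D Q \<longleftrightarrow>
     csubspace D \<and> (\<exists>S. hermitian_sesquilinear_form D S \<and> (\<forall>x\<in>D. Q x = S x x))"

text \<open>Closability is a property of densely defined Hermitian quadratic forms; these standing
  requirements are part of the definition. No semiboundedness is required.\<close>

definition closable :: "'a::complex_inner set \<Rightarrow> ('a \<Rightarrow> complex) \<Rightarrow> bool" where
  "closable D Q \<longleftrightarrow>
     hermitian_quadratic_form D Q \<and> closure D = UNIV \<and>
     (\<forall>\<Phi> :: nat \<Rightarrow> 'a.
        range \<Phi> \<subseteq> D \<and> \<Phi> \<longlonglongrightarrow> 0 \<and>
        ((\<lambda>(n, m). Q (\<Phi> n - \<Phi> m)) \<longlongrightarrow> 0) (sequentially \<times>\<^sub>F sequentially)
        \<longrightarrow> (\<lambda>n. Q (\<Phi> n)) \<longlonglongrightarrow> 0)"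

end

theory Submission
  imports Defs
begin

text \<open>
  If \<open>Q (\<Phi>\<^sub>n - \<Phi>\<^sub>m)\<close> is small for all
  \<open>n, m \<ge> N\<close>, then, for fixed \<open>n \<ge> N\<close> and \<open>m \<rightarrow> \<infinity>\<close>, the cross term
  \<open>2 Re \<langle>T \<Phi>\<^sub>n, \<Phi>\<^sub>m\<rangle>\<close> vanishes because \<open>\<Phi>\<^sub>m \<rightarrow> 0\<close>, so
  \<open>Q \<Phi>\<^sub>n + Q \<Phi>\<^sub>m\<close> is eventually small. Comparing two indices \<open>n, k \<ge> N\<close> through a common
  \<open>m\<close> bounds \<open>Q \<Phi>\<^sub>n - Q \<Phi>\<^sub>k\<close>; taking \<open>k\<close> so large that also
  \<open>Q \<Phi>\<^sub>n + Q \<Phi>\<^sub>k\<close> is small bounds \<open>Q \<Phi>\<^sub>n\<close>.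
\<close>

lemma cinner_diff_right: "cinner x (y - z) = cinner x y - cinner x z"
  using cinner_add_right[of x "y - z" z] by simp

lemma cinner_diff_left: "cinner (x - y) z = cinner x z - cinner y z"
  by (metis cinner_commute cinner_diff_right complex_cnj_diff)

text \<open>The two summands are complex conjugates, so only twice the real part survives.\<close>

lemma cinner_add_cinner_commute: "cinner x y + cinner y x = complex_of_real (2 * inner x y)"
  by (subst (2) cinner_commute) (simp add: complex_add_cnj inner_eq_Re_cinner)

text \<open>Membership in the adjoint domain yields a witness \<open>z\<close>; density makes it
  unique, so it is the value of the adjoint, which is \<open>T x\<close>.\<close>

lemma self_adjoint_symmetric:
  assumes "self_adjoint D T" "x \<in> D" "y \<in> D"
  shows "cinner x (T y) = cinner (T x) y"
proof -
  have dense: "closure D = UNIV" and "x \<in> adjoint_domain D T"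
    and Tx: "adjoint_operator D T x = T x"
    using assms by (auto simp: self_adjoint_def densely_defined_operator_def)
  then obtain z where z: "\<And>w. w \<in> D \<Longrightarrow> cinner x (T w) = cinner z w"
    by (auto simp: adjoint_domain_def)
  have "T x = z"
    using adjoint_operator_eqI[OF dense z] Tx by simp
  with z assms(3) show ?thesis
    by simp
qed

lemma closable_symmetric_operator:
  fixes T :: "'a::complex_inner \<Rightarrow> 'a"
  assumes T: "densely_defined_operator D T"
    and sym: "\<And>x y. x \<in> D \<Longrightarrow> y \<in> D \<Longrightarrow> cinner x (T y) = cinner (T x) y"
  shows "closable D (\<lambda>x. cinner x (T x))"
proof -
  have sub: "csubspace D" and dense: "closure D = UNIV"
    and add: "\<And>x y. x \<in> D \<Longrightarrow> y \<in> D \<Longrightarrow> T (x + y) = T x + T y"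
    and scale: "\<And>c x. x \<in> D \<Longrightarrow> T (c *\<^sub>C x) = c *\<^sub>C T x"
    using T by (auto simp: densely_defined_operator_def)
  have "hermitian_sesquilinear_form D (\<lambda>x y. cinner x (T y))"
    unfolding hermitian_sesquilinear_form_def
    using add scale sym by (metis cinner_add_right cinner_commute cinner_scaleC_right)
  then have form: "hermitian_quadratic_form D (\<lambda>x. cinner x (T x))"
    unfolding hermitian_quadratic_form_def using sub by blast
  \<comment> \<open>Symmetry moves \<open>T\<close> onto \<open>x\<close> in both cross terms: for
    fixed \<open>x\<close> they vanish as \<open>y\<close> tends to 0, without any control of
    \<open>T y\<close>.\<close>
  have expand: "cinner (x - y) (T (x - y))
      = cinner x (T x) + cinner y (T y) - complex_of_real (2 * inner (T x) y)"
    if "x \<in> D" "y \<in> D" for x y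
  proof -
    have "x - y \<in> D"
      using sub that by (rule complex_vector.subspace_diff)
    then have "T (x - y) = T x - T y"
      using add[of "x - y" y] that by simp
    then have "cinner (x - y) (T (x - y))
        = cinner x (T x) + cinner y (T y) - (cinner (T x) y + cinner y (T x))"
      using sym that by (simp add: cinner_diff_left cinner_diff_right)
    then show ?thesis
      by (simp only: cinner_add_cinner_commute)
  qed
  have "(\<lambda>n. cinner (\<Phi> n) (T (\<Phi> n))) \<longlonglongrightarrow> 0"
    if ran: "range \<Phi> \<subseteq> D" and lim: "\<Phi> \<longlonglongrightarrow> 0"
      and Cau: "((\<lambda>(n, m). cinner (\<Phi> n - \<Phi> m) (T (\<Phi> n - \<Phi> m))) \<longlongrightarrow> 0)
        (sequentially \<times>\<^sub>F sequentially)"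
    for \<Phi> :: "nat \<Rightarrow> 'a"
  proof (rule LIMSEQ_I)
    fix e :: real
    assume "0 < e"
    define q where "q n = cinner (\<Phi> n) (T (\<Phi> n))" for n
    \<comment> \<open>Two errors of \<open>e / 6\<close> give the \<open>e / 3\<close> of
      \<open>small\<close>; three of those bound \<open>norm (2 * q n)\<close> by
      \<open>e\<close>.\<close>
    have "\<forall>\<^sub>F (n, m) in sequentially \<times>\<^sub>F sequentially.
        norm (cinner (\<Phi> n - \<Phi> m) (T (\<Phi> n - \<Phi> m))) < e / 6"
      using tendstoD[OF Cau, of "e / 6"] \<open>0 < e\<close> by (simp add: case_prod_unfold)
    then obtain N where N: "\<And>n m. n \<ge> N \<Longrightarrow> m \<ge> N \<Longrightarrow>
        norm (cinner (\<Phi> n - \<Phi> m) (T (\<Phi> n - \<Phi> m))) < e / 6"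
      unfolding eventually_prod_sequentially by auto
    \<comment> \<open>The threshold for \<open>m\<close> depends on \<open>n\<close>, since
      \<open>T (\<Phi> n)\<close> may be unbounded in \<open>n\<close>.\<close>
    have small: "\<forall>\<^sub>F m in sequentially. norm (q n + q m) < e / 3" if "n \<ge> N" for n
    proof -
      have "(\<lambda>m. complex_of_real (2 * inner (T (\<Phi> n)) (\<Phi> m))) \<longlonglongrightarrow>
          complex_of_real (2 * inner (T (\<Phi> n)) 0)"
        by (intro tendsto_intros lim)
      then have "\<forall>\<^sub>F m in sequentially.
          norm (complex_of_real (2 * inner (T (\<Phi> n)) (\<Phi> m))) < e / 6"
        using tendstoD[of _ _ _ "e / 6"] \<open>0 < e\<close> by (fastforce simp: dist_norm)
      then show ?thesis
        using eventually_ge_at_top[of N]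
      proof eventually_elim
        case (elim m)
        have "q n + q m = cinner (\<Phi> n - \<Phi> m) (T (\<Phi> n - \<Phi> m))
            + complex_of_real (2 * inner (T (\<Phi> n)) (\<Phi> m))"
          using expand[OF range_subsetD[OF ran] range_subsetD[OF ran], of n m]
          by (simp add: q_def)
        moreover have "norm (cinner (\<Phi> n - \<Phi> m) (T (\<Phi> n - \<Phi> m))) < e / 6"
          using N that elim(2) .
        ultimately show ?case
          using elim(1) norm_triangle_lt[of "cinner (\<Phi> n - \<Phi> m) (T (\<Phi> n - \<Phi> m))"
            "complex_of_real (2 * inner (T (\<Phi> n)) (\<Phi> m))" "e / 3"] by simp
      qed
    qed
    have "norm (q n) < e" if n: "n \<ge> N" for n
    proof -
      \<comment> \<open>Hence \<open>k\<close> is chosen after \<open>n\<close>, and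
        \<open>m\<close> after both.\<close>
      obtain k where k: "k \<ge> N" "norm (q n + q k) < e / 3"
        using eventually_happens'[OF sequentially_bot
            eventually_conj[OF eventually_ge_at_top[of N] small[OF n]]] by blast
      obtain m where m: "norm (q n + q m) < e / 3" "norm (q k + q m) < e / 3"
        using eventually_happens'[OF sequentially_bot
            eventually_conj[OF small[OF n] small[OF k(1)]]] by blast
      \<comment> \<open>One pair only shows that \<open>q n\<close> is close to
        \<open>- q k\<close>; the alternating sum over the three pairs from \<open>n\<close>,
        \<open>k\<close>, \<open>m\<close> cancels \<open>q k\<close> and
        \<open>q m\<close>.\<close>
      have "2 * q n = (q n + q k) + ((q n + q m) - (q k + q m))"
        by simp
      then have "norm (2 * q n) \<le> norm (q n + q k) + (norm (q n + q m) + norm (q k + q m))"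
        by (metis norm_triangle_le norm_triangle_ineq4 add_left_mono)
      then show ?thesis
        using k m \<open>0 < e\<close> by (simp add: norm_mult)
    qed
    then show "\<exists>N. \<forall>n\<ge>N. norm (cinner (\<Phi> n) (T (\<Phi> n)) - 0) < e"
      by (auto simp: q_def)
  qed
  with form dense show ?thesis
    by (simp add: closable_def)
qed

theorem theorem2p11:
  fixes T :: "'a::chilbert_space \<Rightarrow> 'a" and D :: "'a set"
  assumes "separable_space (euclidean :: 'a topology)"
    and "self_adjoint D T"
  shows "closable D (\<lambda>\<Phi>. cinner \<Phi> (T \<Phi>))"
  using assms(2) by (intro closable_symmetric_operator self_adjoint_symmetric)
    (auto simp: self_adjoint_def)

end
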